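(* Let $n\ge 2$, let $X_1,\dots,X_n$ be real-valued random variables defined on a common probability space $(\Omega,\Sigma,\mathbb{P})$, and let $\mathcal{K}=\{[a,b]\colon a,b\in\mathbb{R},\ a<b\}$. Then the following conditions are equivalent: 1. $X_1,\dots,X_n$ are mutually independent (i.e. $\mathbb{P}_{(X_1,\dots,X_n)}=\mathbb{P}_{X_1}\otimes\dots\otimes\mathbb{P}_{X_n}$); 2. the conditional correlation matrix equals the identity matrix, i.e. $\Sigma_U=I_n$, for any event $U=\{X_1\in A_1,\dots,X_n\in A_n\}$ such that $A_1,\dots,A_n\in\mathcal{K}$ and $\mathbb{P}[U]>0$. Moreover, if $X_1,\dots,X_n$ have finite second moments, then the same equivalence holds when the bounded intervals are replaced with $\mathcal{K}=\{[t,\infty)\colon t\in\mathbb{R}\}$.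
   Context: $\mathbb{P}_Z$ denotes the distribution of a random variable or vector $Z$. For an event $U$ with $\mathbb{P}[U]>0$, $\mathbb{P}[\cdot|U]$ is the conditional probability measure $\mathbb{P}[C|U]=\mathbb{P}[C\cap U]/\mathbb{P}[U]$ and $E[Z|U]=E[Z1_U]/\mathbb{P}[U]$. For $U=\{X_1\in A_1,\dots,X_n\in A_n\}$ with $\mathbb{P}[U]>0$, the conditional covariance, standard deviation and correlation are those calculated with respect to $\mathbb{P}[\cdot|U]$: $$\operatorname{cov}_U(X_i,X_j)=E[X_iX_j|U]-E[X_i|U]E[X_j|U],\quad sd_U(X_i)=\sqrt{E[X_i^2|U]-(E[X_i|U])^2},$$ $$\operatorname{cor}_U(X_i,X_j)=\frac{\operatorname{cov}_U(X_i,X_j)}{sd_U(X_i)\,sd_U(X_j)}.$$ By convention, if $sd_U(X_i)=0$ or $sd_U(X_j)=0$, then $\operatorname{cor}_U(X_i,X_j):=\delta_{ij}$ (Kronecker delta). The conditional correlation matrix $\Sigma_U$ is the $n\times n$ matrix with entries $\Sigma_U[i,j]=\operatorname{cor}_U(X_i,X_j)$, $i,j=1,\dots,n$, and $I_n$ is the $n\times n$ identity matrix. *)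

theory Defs
  imports "HOL-Probability.Probability"
begin

definition cond_mean :: "'a measure \<Rightarrow> 'a set \<Rightarrow> ('a \<Rightarrow> real) \<Rightarrow> real" where
  "cond_mean M U Z = (LINT \<omega>:U|M. Z \<omega>) / measure M U"

definition cond_cov :: "'a measure \<Rightarrow> 'a set \<Rightarrow> ('a \<Rightarrow> real) \<Rightarrow> ('a \<Rightarrow> real) \<Rightarrow> real" where
  "cond_cov M U Y Z = cond_mean M U (\<lambda>\<omega>. Y \<omega> * Z \<omega>) - cond_mean M U Y * cond_mean M U Z"

definition cond_sd :: "'a measure \<Rightarrow> 'a set \<Rightarrow> ('a \<Rightarrow> real) \<Rightarrow> real" where
  "cond_sd M U Z = sqrt (cond_mean M U (\<lambda>\<omega>. (Z \<omega>)\<^sup>2) - (cond_mean M U Z)\<^sup>2)"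

(* The correlation depends on the indices, not only on the two variables: in the degenerate
   case it is the Kronecker delta of i and j, even if X i = X j for distinct i, j. *)
definition cond_cor ::
    "'a measure \<Rightarrow> 'a set \<Rightarrow> ('n \<Rightarrow> 'a \<Rightarrow> real) \<Rightarrow> 'n \<Rightarrow> 'n \<Rightarrow> real" where
  "cond_cor M U X i j =
     (if cond_sd M U (X i) = 0 \<or> cond_sd M U (X j) = 0 then (if i = j then 1 else 0)
      else cond_cov M U (X i) (X j) / (cond_sd M U (X i) * cond_sd M U (X j)))"

definition cond_cor_matrix ::
    "'a measure \<Rightarrow> 'a set \<Rightarrow> ('n::finite \<Rightarrow> 'a \<Rightarrow> real) \<Rightarrow> real^'n^'n" where
  "cond_cor_matrix M U X = (\<chi> i j. cond_cor M U X i j)"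

definition box_event :: "'a measure \<Rightarrow> ('n \<Rightarrow> 'a \<Rightarrow> real) \<Rightarrow> ('n \<Rightarrow> real set) \<Rightarrow> 'a set" where
  "box_event M X A = {\<omega> \<in> space M. \<forall>i. X i \<omega> \<in> A i}"

definition cond_uncorrelated ::
    "'a measure \<Rightarrow> ('n::finite \<Rightarrow> 'a \<Rightarrow> real) \<Rightarrow> real set set \<Rightarrow> bool" where
  "cond_uncorrelated M X K \<longleftrightarrow>
     (\<forall>A. (\<forall>i. A i \<in> K) \<and> measure M (box_event M X A) > 0 \<longrightarrow>
        cond_cor_matrix M (box_event M X A) X = mat 1)"

end

theory Submission
  imports Defs
begin

text \<open>
  If the variables are independent, then they remain independent given a box, and the conditional
  covariances are \<open>0\<close>. The substance is the converse.

  Take two variables \<open>X\<close>, \<open>Y\<close> and a box \<open>B\<close>, and put \<open>H s t = E ((X - s)\<^sup>+ (Y - t)\<^sup>+; B)\<close>. The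
  probability of \<open>B \<inter> {X \<ge> s, Y \<ge> t}\<close> and the integrals of \<open>X - s\<close>, \<open>Y - t\<close> and
  \<open>(X - s) (Y - t)\<close> over this event are, up to sign, \<open>\<partial>\<^sub>s \<partial>\<^sub>t H\<close>, \<open>\<partial>\<^sub>t H\<close>, \<open>\<partial>\<^sub>s H\<close> and \<open>H\<close>.
  Wherever \<open>H\<close> is positive, the event is again a box of the class, so vanishing covariance means
  \<open>(\<partial>\<^sub>s \<partial>\<^sub>t H) H = (\<partial>\<^sub>s H) (\<partial>\<^sub>t H)\<close>: the mixed derivative of \<open>ln H\<close> is \<open>0\<close>. Hence \<open>H\<close> is a
  product of a function of \<open>s\<close> and a function of \<open>t\<close>, and so is the joint tail. Probabilistically, each
  integration says that the mean excess function \<open>E (Z - t | Z \<ge> t)\<close> determines a law up to a factor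
  (\<open>tail_weights_proportional\<close>). The analytic core \<open>proportional_if_log_derivatives_eq\<close>
  deals with the two obstacles: \<open>H\<close> need not be differentiable everywhere, and it may vanish.

  This makes each pair \<open>X i\<close>, \<open>X j\<close> independent given restrictions of the remaining variables
  (\<open>tail_independence_on_event\<close>, \<open>tail_exchange\<close>). Because these restrictions are arbitrary half-lines,
  induction on the number of restricted coordinates (\<open>prod_if_two_point_exchange\<close>) yields the product
  formula for the joint tails, which characterises mutual independence.

  Bounded intervals and half-lines are two instances of one notion, \<open>conditioning_class\<close>. With bounded
  intervals the upper end points stay fixed while the lower ones move; the upper ends are
  released only afterwards, together with the lower ones.
\<close>

section \<open>Convex functions with the same logarithmic derivative\<close>

text \<open>
  A substitute for the theorem on vanishing derivatives, for functions that may fail to be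
  differentiable on a countable set. Cut \<open>[a, b]\<close> into \<open>n\<close> equal pieces: the bounds on the
  increments telescope to \<open>(b - a) / n * (\<phi> a - \<phi> b)\<close>, which tends to \<open>0\<close>.
\<close>

lemma eq_if_increments_quadratically_small:
  fixes R \<phi> :: "real \<Rightarrow> real"
  assumes "a \<le> b"
    and step: "\<And>s t. a \<le> s \<Longrightarrow> s \<le> t \<Longrightarrow> t \<le> b \<Longrightarrow> \<bar>R t - R s\<bar> \<le> (t - s) * (\<phi> s - \<phi> t)"
  shows "R a = R b"
proof -
  define C where "C = (b - a) * (\<phi> a - \<phi> b)"
  have bound: "\<bar>R b - R a\<bar> \<le> C * inverse (real (Suc n))" for n
  proof -
    define h where "h = (b - a) / real (Suc n)"
    define x where "x k = a + real k * h" for k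
    have h: "0 \<le> h" using \<open>a \<le> b\<close> by (simp add: h_def)
    have x_ends: "x 0 = a" "x (Suc n) = b" by (simp_all add: x_def h_def)
    have incr: "\<bar>R (x (Suc k)) - R (x k)\<bar> \<le> h * (\<phi> (x k) - \<phi> (x (Suc k)))"
      if "k < Suc n" for k
    proof -
      have "real (Suc k) * h \<le> real (Suc n) * h"
        using that h by (intro mult_right_mono) auto
      then have "x (Suc k) \<le> b"
        using x_ends by (simp add: x_def)
      moreover have "a \<le> x k" "x (Suc k) - x k = h"
        using h by (simp_all add: x_def algebra_simps)
      ultimately show ?thesis
        using step[of "x k" "x (Suc k)"] h by simp
    qed
    have "\<bar>R b - R a\<bar> = \<bar>\<Sum>k<Suc n. R (x (Suc k)) - R (x k)\<bar>"
      using sum_lessThan_telescope[of "\<lambda>k. R (x k)" "Suc n"] by (simp only: x_ends)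
    also have "\<dots> \<le> (\<Sum>k<Suc n. h * (\<phi> (x k) - \<phi> (x (Suc k))))"
      by (rule order_trans[OF sum_abs]) (intro sum_mono incr, simp)
    also have "\<dots> = h * (\<phi> a - \<phi> b)"
      using sum_lessThan_telescope'[of "\<lambda>k. \<phi> (x k)" "Suc n"]
      by (simp only: sum_distrib_left[symmetric] x_ends)
    also have "\<dots> = C * inverse (real (Suc n))"
      by (simp add: C_def h_def divide_inverse mult_ac)
    finally show ?thesis .
  qed
  have "(\<lambda>n. C * inverse (real (Suc n))) \<longlonglongrightarrow> C * 0"
    by (intro tendsto_intros LIMSEQ_inverse_real_of_nat)
  then have "\<bar>R b - R a\<bar> \<le> C * 0"
    by (rule LIMSEQ_le_const) (use bound in blast)
  then show ?thesis by simp
qed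

text \<open>
  The inequality \<open>diff_le\<close>, together with its mirror image obtained by swapping \<open>s\<close> and \<open>t\<close>, says
  that \<open>F\<close> is convex with \<open>- f t\<close> as a subgradient at each \<open>t\<close>, hence that \<open>f\<close> is one version of
  the derivative of \<open>- F\<close>. The model is \<open>F t = E (Z - t)\<^sup>+\<close> with \<open>f t = P (Z \<ge> t)\<close>.
\<close>

locale tail_primitive =
  fixes F f :: "real \<Rightarrow> real"
  assumes diff_le: "F s - F t \<le> (t - s) * f s"
    and rate_nonneg: "0 \<le> f t"
    and nonneg: "0 \<le> F t"
begin

lemma antimono: "s \<le> t \<Longrightarrow> F t \<le> F s"
  using diff_le[of t s] mult_nonneg_nonneg[of "t - s" "f t"] rate_nonneg[of t]
  by (simp add: algebra_simps)

lemma diff_ge: "(t - s) * f t \<le> F s - F t"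
  using diff_le[of t s] by (simp add: algebra_simps)

lemma rate_antimono:
  assumes "s \<le> t" shows "f t \<le> f s"
proof (cases "s = t")
  case False
  have "(t - s) * f t \<le> (t - s) * f s"
    using diff_ge diff_le order_trans by blast
  with False assms show ?thesis by simp
qed simp

lemma continuous_on_interval: "continuous_on {a..b} F"
proof -
  have "(f a)-lipschitz_on {a..b} F"
  proof (rule lipschitz_onI)
    fix s t assume st: "s \<in> {a..b}" "t \<in> {a..b}"
    have *: "\<bar>F s - F t\<bar> \<le> f a * (t - s)" if "a \<le> s" "s \<le> t" for s t
    proof -
      have "(t - s) * f s \<le> (t - s) * f a"
        using that rate_antimono by (intro mult_left_mono) auto
      then show ?thesis
        using diff_le[of s t] antimono[of s t] that by (simp add: mult_ac)
    qed
    show "dist (F s) (F t) \<le> f a * dist s t"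
      using *[of s t] *[of t s] st
      by (cases "s \<le> t") (auto simp: dist_real_def abs_minus_commute)
  qed (rule rate_nonneg)
  then show ?thesis by (rule lipschitz_on_continuous_on)
qed

end

text \<open>
  The hypothesis states that \<open>F\<close> and \<open>G\<close> have the same logarithmic derivative, so \<open>G / F\<close> is constant
  on the set \<open>F > 0\<close>. Where \<open>F\<close> vanishes, \<open>G\<close> must vanish as well: if the decreasing function \<open>G\<close>
  were positive there, then \<open>G = c F\<close> would keep \<open>F\<close> away from \<open>0\<close> on the whole set \<open>F > 0\<close>, while \<open>F\<close> decreases continuously to \<open>0\<close>. In the application this is what prevents the joint law from
  having a support that is not a product.
\<close>

lemma proportional_if_log_derivatives_eq:
  assumes "tail_primitive F f" and "tail_primitive G g"
    and rates: "\<And>t. F t > 0 \<Longrightarrow> g t * F t = f t * G t"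
    and "F t0 > 0"
  obtains c where "\<And>t. G t = c * F t"
proof -
  interpret F: tail_primitive F f by fact
  interpret G: tail_primitive G g by fact
  have ratio: "G a / F a = G b / F b" if "a \<le> b" "F b > 0" for a b
  proof (rule eq_if_increments_quadratically_small[OF \<open>a \<le> b\<close>])
    fix s t assume st: "a \<le> s" "s \<le> t" "t \<le> b"
    define D where "D = (f s - f t) + (g s - g t)"
    have Fpos: "F b \<le> F t" "F b \<le> F s" "F s \<le> F a" "G s \<le> G a"
      using st by (auto intro: F.antimono G.antimono)
    have Ft: "F t > 0" and Fs: "F s > 0"
      using Fpos \<open>F b > 0\<close> by linarith+
    \<comment> \<open>The errors of the linear approximations of \<open>F\<close> and \<open>G\<close> at \<open>s\<close>. The first-order terms in the
      increment of \<open>G / F\<close> cancel by the hypothesis, so that only these errors remain.\<close>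
    define p where "p = (t - s) * f s - (F s - F t)"
    define q where "q = (t - s) * g s - (G s - G t)"
    have pq: "0 \<le> p" "p \<le> (t - s) * (f s - f t)" "0 \<le> q" "q \<le> (t - s) * (g s - g t)"
      using F.diff_le[of s t] F.diff_ge[of t s] G.diff_le[of s t] G.diff_ge[of t s]
      by (simp_all add: p_def q_def right_diff_distrib)
    have "G t * F s - G s * F t = F s * q - G s * p + (t - s) * (f s * G s - g s * F s)"
      by (simp add: p_def q_def algebra_simps)
    then have num: "G t * F s - G s * F t = F s * q - G s * p"
      using rates[OF Fs] by simp
    have "\<bar>F s * q - G s * p\<bar> \<le> F s * q + G s * p"
      using pq Fs G.nonneg[of s] by (simp add: abs_le_iff)
    also have "\<dots> \<le> F a * ((t - s) * (g s - g t)) + G a * ((t - s) * (f s - f t))"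
      using pq Fs Fpos G.nonneg[of s] by (intro add_mono mult_mono) auto
    also have "\<dots> \<le> (F a + G a) * ((t - s) * D)"
      using pq Fs Fpos G.nonneg[of s] mult_nonneg_nonneg[of "F a" "(t - s) * (f s - f t)"]
        mult_nonneg_nonneg[of "G a" "(t - s) * (g s - g t)"]
      by (simp add: D_def algebra_simps)
    finally have num_le: "\<bar>G t * F s - G s * F t\<bar> \<le> (F a + G a) * ((t - s) * D)"
      using num by simp
    have den: "F b * F b \<le> F t * F s"
      using Fpos \<open>F b > 0\<close> by (intro mult_mono) auto
    have "\<bar>G t / F t - G s / F s\<bar> = \<bar>G t * F s - G s * F t\<bar> / (F t * F s)"
      using Ft Fs by (simp add: diff_frac_eq abs_mult)
    also have "\<dots> \<le> (F a + G a) * ((t - s) * D) / (F b * F b)"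
      using num_le den \<open>F b > 0\<close> by (intro frac_le) auto
    also have "\<dots> = (t - s) * ((F a + G a) / (F b * F b) * (f s + g s)
                            - (F a + G a) / (F b * F b) * (f t + g t))"
      by (simp add: D_def algebra_simps diff_divide_distrib add_divide_distrib)
    finally show "\<bar>G t / F t - G s / F s\<bar> \<le>
        (t - s) * ((F a + G a) / (F b * F b) * (f s + g s)
                   - (F a + G a) / (F b * F b) * (f t + g t))" .
  qed
  define c where "c = G t0 / F t0"
  have c_pos: "G t = c * F t" if "F t > 0" for t
  proof -
    have "G t / F t = c"
      using ratio[of t t0] ratio[of t0 t] that \<open>F t0 > 0\<close> unfolding c_def
      by (metis linorder_le_cases)
    then show ?thesis using that by (simp add: nonzero_divide_eq_eq)
  qed
  have "G t = c * F t" if "\<not> F t > 0" for t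
  proof (rule ccontr)
    assume contra: "G t \<noteq> c * F t"
    have Ft: "F t = 0" using that F.nonneg[of t] by simp
    then have Gt: "G t > 0" using contra G.nonneg[of t] by simp
    have le: "t0 \<le> t"
      using F.antimono[of t t0] Ft \<open>F t0 > 0\<close> by linarith
    have "c * F t0 \<ge> G t"
      using G.antimono[OF le] c_pos[OF \<open>F t0 > 0\<close>] by simp
    then have "c > 0"
      using Gt \<open>F t0 > 0\<close> by (metis less_le_trans zero_less_mult_pos2)
    have "G t / (2 * c) \<le> F t0"
      using \<open>c * F t0 \<ge> G t\<close> \<open>c > 0\<close> Gt by (simp add: field_simps)
    moreover have "F t \<le> G t / (2 * c)"
      using Ft Gt \<open>c > 0\<close> by simp
    \<comment> \<open>A point where \<open>F\<close> is positive but too small for \<open>G t \<le> c * F\<close> to hold.\<close>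
    ultimately obtain x where x: "t0 \<le> x" "x \<le> t" "F x = G t / (2 * c)"
      using IVT2'[of F t "G t / (2 * c)" t0] le F.continuous_on_interval by blast
    have "F x > 0" using x Gt \<open>c > 0\<close> by simp
    then have "G x = G t / 2" using c_pos[of x] x \<open>c > 0\<close> by simp
    then show False using G.antimono[OF \<open>x \<le> t\<close>] Gt by simp
  qed
  then show thesis using that c_pos by blast
qed

section \<open>The mean excess function determines the tails\<close>

definition tail_weight :: "'a measure \<Rightarrow> ('a \<Rightarrow> real) \<Rightarrow> ('a \<Rightarrow> real) \<Rightarrow> real \<Rightarrow> real" where
  "tail_weight M u Z t = (\<integral>\<omega>. u \<omega> * indicator {t..} (Z \<omega>) \<partial>M)"

definition excess_weight :: "'a measure \<Rightarrow> ('a \<Rightarrow> real) \<Rightarrow> ('a \<Rightarrow> real) \<Rightarrow> real \<Rightarrow> real" where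
  "excess_weight M u Z t = (\<integral>\<omega>. u \<omega> * max 0 (Z \<omega> - t) \<partial>M)"

text \<open>
  A nonnegative weight \<open>u\<close> plays the part of an unnormalised density, so that one fixed measure carries
  all laws that have to be compared. The event on which everything is conditioned, and the positive
  part of another variable, are both absorbed into \<open>u\<close>.
\<close>

locale weighted_variable =
  fixes M :: "'a measure" and u Z :: "'a \<Rightarrow> real"
  assumes Z_meas [measurable]: "Z \<in> borel_measurable M"
    and weight_nonneg: "0 \<le> u \<omega>"
    and integrable_weight: "integrable M u"
    and integrable_first_moment: "integrable M (\<lambda>\<omega>. u \<omega> * Z \<omega>)"
begin

lemma weight_meas [measurable]: "u \<in> borel_measurable M"
  using integrable_weight by auto

lemma integrable_tail: "integrable M (\<lambda>\<omega>. u \<omega> * indicator {t..} (Z \<omega>))"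
  by (rule Bochner_Integration.integrable_bound[OF integrable_weight])
     (auto simp: indicator_def)

lemma integrable_excess: "integrable M (\<lambda>\<omega>. u \<omega> * max 0 (Z \<omega> - t))"
proof (rule Bochner_Integration.integrable_bound)
  show "integrable M (\<lambda>\<omega>. u \<omega> * Z \<omega> - t * u \<omega>)"
    using integrable_weight integrable_first_moment by auto
  show "AE \<omega> in M. norm (u \<omega> * max 0 (Z \<omega> - t)) \<le> norm (u \<omega> * Z \<omega> - t * u \<omega>)"
  proof (rule AE_I2)
    fix \<omega>
    have "u \<omega> * Z \<omega> - t * u \<omega> = u \<omega> * (Z \<omega> - t)"
      by (simp add: algebra_simps)
    then have "norm (u \<omega> * Z \<omega> - t * u \<omega>) = u \<omega> * \<bar>Z \<omega> - t\<bar>"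
      using weight_nonneg[of \<omega>] by (simp only: real_norm_def abs_mult abs_of_nonneg)
    then show "norm (u \<omega> * max 0 (Z \<omega> - t)) \<le> norm (u \<omega> * Z \<omega> - t * u \<omega>)"
      using weight_nonneg[of \<omega>] by (simp add: abs_mult mult_left_mono)
  qed
qed measurable

lemma tail_primitive_excess: "tail_primitive (excess_weight M u Z) (tail_weight M u Z)"
proof
  fix s t
  have "excess_weight M u Z s - excess_weight M u Z t =
      (\<integral>\<omega>. u \<omega> * max 0 (Z \<omega> - s) - u \<omega> * max 0 (Z \<omega> - t) \<partial>M)"
    unfolding excess_weight_def
    by (intro Bochner_Integration.integral_diff[symmetric] integrable_excess)
  also have "\<dots> \<le> (\<integral>\<omega>. (t - s) * (u \<omega> * indicator {s..} (Z \<omega>)) \<partial>M)"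
  proof (rule integral_mono)
    fix \<omega>
    have "max 0 (Z \<omega> - s) - max 0 (Z \<omega> - t) \<le> (t - s) * indicator {s..} (Z \<omega>)"
      by (auto simp: indicator_def)
    from mult_left_mono[OF this weight_nonneg[of \<omega>]]
    show "u \<omega> * max 0 (Z \<omega> - s) - u \<omega> * max 0 (Z \<omega> - t) \<le>
        (t - s) * (u \<omega> * indicator {s..} (Z \<omega>))"
      by (simp only: right_diff_distrib mult_ac)
  qed (auto intro: integrable_excess integrable_tail)
  also have "\<dots> = (t - s) * tail_weight M u Z s"
    by (simp add: tail_weight_def)
  finally show "excess_weight M u Z s - excess_weight M u Z t \<le> (t - s) * tail_weight M u Z s" .
qed (auto simp: excess_weight_def tail_weight_def weight_nonneg intro!: integral_nonneg)

text \<open>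
  The excess determines the tail pointwise, atoms included, since the quotients are taken from the
  left and the tail of a closed half-line is left-continuous.
\<close>

lemma excess_difference_quotient_LIMSEQ:
  "(\<lambda>n. real n * (excess_weight M u Z (t - 1 / real n) - excess_weight M u Z t))
     \<longlonglongrightarrow> tail_weight M u Z t"
proof -
  define q where "q n \<omega> = real n * (max 0 (Z \<omega> - (t - 1 / real n)) - max 0 (Z \<omega> - t))" for n \<omega>
  have "(\<lambda>n. \<integral>\<omega>. u \<omega> * q n \<omega> \<partial>M) \<longlonglongrightarrow> (\<integral>\<omega>. u \<omega> * indicator {t..} (Z \<omega>) \<partial>M)"
  proof (rule integral_dominated_convergence[where w = u])
    show "AE \<omega> in M. (\<lambda>n. u \<omega> * q n \<omega>) \<longlonglongrightarrow> u \<omega> * indicator {t..} (Z \<omega>)"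
    proof (intro AE_I2 tendsto_mult_left)
      fix \<omega>
      show "(\<lambda>n. q n \<omega>) \<longlonglongrightarrow> indicator {t..} (Z \<omega>)"
      proof (cases "Z \<omega> \<ge> t")
        case True
        have "eventually (\<lambda>n. q n \<omega> = 1) sequentially"
          using eventually_gt_at_top[of 0]
        proof eventually_elim
          case (elim n)
          have "max 0 (Z \<omega> - (t - 1 / real n)) = Z \<omega> - t + 1 / real n" "max 0 (Z \<omega> - t) = Z \<omega> - t"
            using True zero_le_divide_1_iff[of "real n"] by linarith+
          then show ?case using elim by (simp add: q_def)
        qed
        then show ?thesis using True by (simp add: tendsto_eventually)
      next
        case False
        have "(\<lambda>n. 1 / real n) \<longlonglongrightarrow> 0" by (rule lim_1_over_n)
        then have "eventually (\<lambda>n. 1 / real n < t - Z \<omega>) sequentially"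
          using False by (intro order_tendstoD) auto
        then have "eventually (\<lambda>n. q n \<omega> = 0) sequentially"
          by eventually_elim (use False in \<open>auto simp: q_def max_def\<close>)
        then show ?thesis using False by (simp add: tendsto_eventually)
      qed
    qed
    show "AE \<omega> in M. norm (u \<omega> * q n \<omega>) \<le> u \<omega>" for n
    proof (rule AE_I2)
      fix \<omega>
      have "\<bar>q n \<omega>\<bar> \<le> 1"
      proof (cases "n = 0")
        case False
        have "\<bar>max 0 (Z \<omega> - (t - 1 / real n)) - max 0 (Z \<omega> - t)\<bar> \<le> 1 / real n"
          using zero_le_divide_1_iff[of "real n"] by linarith
        then have "real n * \<bar>max 0 (Z \<omega> - (t - 1 / real n)) - max 0 (Z \<omega> - t)\<bar> \<le> real n * (1 / real n)"
          by (intro mult_left_mono) auto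
        then show ?thesis using False by (simp add: q_def abs_mult)
      qed (simp add: q_def)
      then show "norm (u \<omega> * q n \<omega>) \<le> u \<omega>"
        using weight_nonneg[of \<omega>] by (simp add: abs_mult mult_left_le)
    qed
  qed (auto simp: q_def intro: integrable_weight)
  moreover have "(\<integral>\<omega>. u \<omega> * q n \<omega> \<partial>M) =
      real n * (excess_weight M u Z (t - 1 / real n) - excess_weight M u Z t)" for n
  proof -
    have "(\<integral>\<omega>. u \<omega> * q n \<omega> \<partial>M) = (\<integral>\<omega>. real n * (u \<omega> * max 0 (Z \<omega> - (t - 1 / real n))
        - u \<omega> * max 0 (Z \<omega> - t)) \<partial>M)"
      by (intro Bochner_Integration.integral_cong) (auto simp: q_def algebra_simps)
    also have "\<dots> = real n * (excess_weight M u Z (t - 1 / real n) - excess_weight M u Z t)"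
      unfolding excess_weight_def
      by (subst integral_mult_right_zero, subst Bochner_Integration.integral_diff)
         (auto intro: integrable_excess)
    finally show ?thesis .
  qed
  ultimately show ?thesis by (simp add: tail_weight_def)
qed

lemma tail_weight_LIMSEQ: "(\<lambda>n. tail_weight M u Z (- real n)) \<longlonglongrightarrow> (\<integral>\<omega>. u \<omega> \<partial>M)"
  unfolding tail_weight_def
proof (rule integral_dominated_convergence[where w = u])
  show "AE \<omega> in M. (\<lambda>n. u \<omega> * indicator {- real n..} (Z \<omega>)) \<longlonglongrightarrow> u \<omega>"
  proof (rule AE_I2)
    fix \<omega>
    have "eventually (\<lambda>n. u \<omega> * indicator {- real n..} (Z \<omega>) = u \<omega>) sequentially"
      using eventually_ge_at_top[of "nat \<lceil>- Z \<omega>\<rceil>"]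
      by eventually_elim (auto simp: indicator_def ceiling_le_iff nat_le_iff)
    then show "(\<lambda>n. u \<omega> * indicator {- real n..} (Z \<omega>)) \<longlonglongrightarrow> u \<omega>"
      by (rule tendsto_eventually)
  qed
qed (auto simp: indicator_def weight_nonneg intro: integrable_weight)

end

text \<open>
  Where the excess under \<open>u\<close> is positive, the hypothesis says that \<open>Z\<close> has the same mean excess
  \<open>E (Z - t | Z \<ge> t)\<close> under \<open>u\<close> and under \<open>v\<close>. Up to sign, the mean excess function is the
  reciprocal of the logarithmic derivative of the excess, so it determines the law up to a factor;
  comparing the tails at minus infinity identifies the factor as the quotient of the total weights.
\<close>

lemma tail_weights_proportional:
  assumes "weighted_variable M u Z" and "weighted_variable M v Z"
    and mean_excess: "\<And>t. excess_weight M u Z t > 0 \<Longrightarrow>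
      tail_weight M v Z t * excess_weight M u Z t = tail_weight M u Z t * excess_weight M v Z t"
  shows "tail_weight M v Z t * (\<integral>\<omega>. u \<omega> \<partial>M) = tail_weight M u Z t * (\<integral>\<omega>. v \<omega> \<partial>M)"
proof -
  interpret u: weighted_variable M u Z by fact
  interpret v: weighted_variable M v Z by fact
  consider t0 where "excess_weight M u Z t0 > 0" | "\<And>t. excess_weight M u Z t = 0"
    using tail_primitive.nonneg[OF u.tail_primitive_excess] by (metis order_le_less)
  then show ?thesis
  proof cases
    case 1
    obtain c where "\<And>t. excess_weight M v Z t = c * excess_weight M u Z t"
      using proportional_if_log_derivatives_eq[OF u.tail_primitive_excess v.tail_primitive_excess mean_excess 1] by blast
    then have "(\<lambda>n. c * (real n * (excess_weight M u Z (t - 1 / real n) - excess_weight M u Z t)))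
        \<longlonglongrightarrow> tail_weight M v Z t" for t
      using v.excess_difference_quotient_LIMSEQ[of t] by (simp add: algebra_simps)
    from LIMSEQ_unique[OF this tendsto_mult_left[OF u.excess_difference_quotient_LIMSEQ]]
    have tails: "tail_weight M v Z t = c * tail_weight M u Z t" for t .
    have "(\<integral>\<omega>. v \<omega> \<partial>M) = c * (\<integral>\<omega>. u \<omega> \<partial>M)"
      using LIMSEQ_unique[OF v.tail_weight_LIMSEQ]
        tendsto_mult_left[OF u.tail_weight_LIMSEQ, of c] by (simp add: tails)
    with tails show ?thesis by simp
  next
    case 2
    have tails: "tail_weight M u Z t = 0" for t
      using LIMSEQ_unique[OF u.excess_difference_quotient_LIMSEQ[of t]] by (simp add: 2)
    have "(\<integral>\<omega>. u \<omega> \<partial>M) = 0"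
      using LIMSEQ_unique[OF u.tail_weight_LIMSEQ] by (simp add: tails)
    with tails show ?thesis by simp
  qed
qed

section \<open>Independence of two tails on an event\<close>

text \<open>
  Covariances do not change under shifts, so the hypothesis also gives
  \<open>P U * E ((X - s) (Y - t); U) = E (X - s; U) * E (Y - t; U)\<close> on \<open>U = B \<inter> {X \<ge> s, Y \<ge> t}\<close>.
  With \<open>H s t = E ((X - s)\<^sup>+ (Y - t)\<^sup>+; B)\<close> this equation reads
  \<open>(\<partial>\<^sub>s \<partial>\<^sub>t H) H = (\<partial>\<^sub>s H) (\<partial>\<^sub>t H)\<close>, that is, the mixed derivative of \<open>ln H\<close> vanishes; so \<open>H\<close>,
  and with it the joint tail \<open>\<partial>\<^sub>s \<partial>\<^sub>t H\<close>, is a product. The two integrations are two applications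
  of \<open>tail_weights_proportional\<close>, first in \<open>t\<close> and then in \<open>s\<close>.
\<close>

lemma tail_independence_on_event:
  fixes X Y :: "'a \<Rightarrow> real"
  assumes "finite_measure M" and B [measurable]: "B \<in> sets M"
    and [measurable]: "X \<in> borel_measurable M" "Y \<in> borel_measurable M"
    and int_X: "set_integrable M B X" and int_Y: "set_integrable M B Y"
    and int_XY: "set_integrable M B (\<lambda>\<omega>. X \<omega> * Y \<omega>)"
    and uncorrelated: "\<And>s t. measure M {\<omega> \<in> B. s < X \<omega> \<and> t < Y \<omega>} > 0 \<Longrightarrow>
      measure M {\<omega> \<in> B. s \<le> X \<omega> \<and> t \<le> Y \<omega>} * (LINT \<omega>:{\<omega> \<in> B. s \<le> X \<omega> \<and> t \<le> Y \<omega>}|M. X \<omega> * Y \<omega>)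
        = (LINT \<omega>:{\<omega> \<in> B. s \<le> X \<omega> \<and> t \<le> Y \<omega>}|M. X \<omega>) * (LINT \<omega>:{\<omega> \<in> B. s \<le> X \<omega> \<and> t \<le> Y \<omega>}|M. Y \<omega>)"
  shows "measure M {\<omega> \<in> B. s \<le> X \<omega> \<and> t \<le> Y \<omega>} * measure M B
       = measure M {\<omega> \<in> B. s \<le> X \<omega>} * measure M {\<omega> \<in> B. t \<le> Y \<omega>}"
proof -
  interpret finite_measure M by fact
  have B_space: "B \<subseteq> space M" using B by (rule sets.sets_into_space)
  have ev_eq: "{\<omega> \<in> B. P \<omega>} = B \<inter> {\<omega> \<in> space M. P \<omega>}" for P
    using B_space by auto
  have ev_X [measurable]: "{\<omega> \<in> B. s \<le> X \<omega>} \<in> sets M" for s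
    unfolding ev_eq by measurable
  have ev_Y [measurable]: "{\<omega> \<in> B. t \<le> Y \<omega>} \<in> sets M" for t
    unfolding ev_eq by measurable
  have ev_XY [measurable]: "{\<omega> \<in> B. s \<le> X \<omega> \<and> t \<le> Y \<omega>} \<in> sets M" for s t
    unfolding ev_eq by measurable
  have ev_XY_strict [measurable]: "{\<omega> \<in> B. s < X \<omega> \<and> t < Y \<omega>} \<in> sets M" for s t
    unfolding ev_eq by measurable
  define w where "w s \<omega> = indicator B \<omega> * max 0 (X \<omega> - s)" for s \<omega>
  have w_meas [measurable]: "w s \<in> borel_measurable M" for s
    unfolding w_def by measurable

  have ind: "integrable M (indicator A :: 'a \<Rightarrow> real)" if "A \<in> sets M" for A
    using that by (simp add: integrable_real_indicator emeasure_eq_measure)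
  have sub: "set_integrable M A X" "set_integrable M A Y" "set_integrable M A (\<lambda>\<omega>. X \<omega> * Y \<omega>)"
    if "A \<in> sets M" "A \<subseteq> B" for A
    using that int_X int_Y int_XY by (auto intro: set_integrable_subset)

  have weight_ind_X: "weighted_variable M (indicator A) X" if "A \<in> sets M" "A \<subseteq> B" for A
    using ind[OF that(1)] sub(1)[OF that] by unfold_locales (auto simp: set_integrable_def)
  have weight_ind_Y: "weighted_variable M (indicator A) Y" if "A \<in> sets M" "A \<subseteq> B" for A
    using ind[OF that(1)] sub(2)[OF that] by unfold_locales (auto simp: set_integrable_def)
  have weight_w: "weighted_variable M (w s) Y" for s
  proof
    show "integrable M (w s)"
      unfolding w_def using weighted_variable.integrable_excess[OF weight_ind_X[OF B]] by simp
    have "integrable M (\<lambda>\<omega>. indicator {\<omega> \<in> B. s \<le> X \<omega>} \<omega> * (X \<omega> * Y \<omega>)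
        - s * (indicator {\<omega> \<in> B. s \<le> X \<omega>} \<omega> * Y \<omega>))"
      using sub[OF ev_X[of s]] by (intro Bochner_Integration.integrable_diff integrable_mult_right)
        (auto simp: set_integrable_def)
    also have "(\<lambda>\<omega>. indicator {\<omega> \<in> B. s \<le> X \<omega>} \<omega> * (X \<omega> * Y \<omega>)
        - s * (indicator {\<omega> \<in> B. s \<le> X \<omega>} \<omega> * Y \<omega>)) = (\<lambda>\<omega>. w s \<omega> * Y \<omega>)"
      by (auto simp: w_def indicator_def fun_eq_iff algebra_simps)
    finally show "integrable M (\<lambda>\<omega>. w s \<omega> * Y \<omega>)" .
  qed (auto simp: w_def)

  \<comment> \<open>For fixed \<open>s\<close>, zero covariance on \<open>{X \<ge> s, Y \<ge> t}\<close> for all \<open>t\<close> says that \<open>Y\<close> has the same mean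
    excess under the weights \<open>(X - s)\<^sup>+\<close> and \<open>1 {X \<ge> s}\<close> on \<open>B\<close>; hence its two laws are proportional.\<close>
  have swap: "measure M {\<omega> \<in> B. s \<le> X \<omega> \<and> t \<le> Y \<omega>} * (\<integral>\<omega>. w s \<omega> \<partial>M)
      = tail_weight M (w s) Y t * measure M {\<omega> \<in> B. s \<le> X \<omega>}" for s t
  proof -
    let ?v = "indicator {\<omega> \<in> B. s \<le> X \<omega>} :: 'a \<Rightarrow> real"
    have tail_v: "tail_weight M ?v Y t = measure M {\<omega> \<in> B. s \<le> X \<omega> \<and> t \<le> Y \<omega>}" for t
    proof -
      have "tail_weight M ?v Y t = (\<integral>\<omega>. indicator {\<omega> \<in> B. s \<le> X \<omega> \<and> t \<le> Y \<omega>} \<omega> \<partial>M)"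
        unfolding tail_weight_def
        by (intro Bochner_Integration.integral_cong) (auto simp: indicator_def)
      then show ?thesis by (simp add: Int_absorb1[OF sets.sets_into_space] Int_commute)
    qed
    have "tail_weight M ?v Y t * (\<integral>\<omega>. w s \<omega> \<partial>M) = tail_weight M (w s) Y t * (\<integral>\<omega>. ?v \<omega> \<partial>M)"
    proof (rule tail_weights_proportional[OF weight_w weight_ind_Y])
      fix t assume pos: "0 < excess_weight M (w s) Y t"
      define U where "U = {\<omega> \<in> B. s \<le> X \<omega> \<and> t \<le> Y \<omega>}"
      have U: "U \<in> sets M" "U \<subseteq> B" by (auto simp: U_def)
      have iX: "integrable M (\<lambda>\<omega>. indicator U \<omega> * X \<omega>)"
       and iY: "integrable M (\<lambda>\<omega>. indicator U \<omega> * Y \<omega>)"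
       and iXY: "integrable M (\<lambda>\<omega>. indicator U \<omega> * (X \<omega> * Y \<omega>))"
        using sub[OF U] by (auto simp: set_integrable_def)
      have i1: "integrable M (indicator U :: 'a \<Rightarrow> real)" by (rule ind[OF U(1)])
      define p where "p = measure M U"
      have p: "measure M (U \<inter> space M) = p"
        using sets.sets_into_space[OF U(1)] by (simp add: p_def Int_absorb2)
      define a where "a = (\<integral>\<omega>. indicator U \<omega> * X \<omega> \<partial>M)"
      define b where "b = (\<integral>\<omega>. indicator U \<omega> * Y \<omega> \<partial>M)"
      define c where "c = (\<integral>\<omega>. indicator U \<omega> * (X \<omega> * Y \<omega>) \<partial>M)"
      have "measure M {\<omega> \<in> B. s < X \<omega> \<and> t < Y \<omega>} \<noteq> 0"
      proof
        assume null: "measure M {\<omega> \<in> B. s < X \<omega> \<and> t < Y \<omega>} = 0"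
        have "AE \<omega> in M. \<omega> \<notin> {\<omega> \<in> B. s < X \<omega> \<and> t < Y \<omega>}"
          using null by (intro AE_not_in null_setsI) (auto simp: emeasure_eq_measure)
        then have "AE \<omega> in M. w s \<omega> * max 0 (Y \<omega> - t) = 0"
          by eventually_elim (auto simp: w_def indicator_def max_def)
        then have "excess_weight M (w s) Y t = 0"
          unfolding excess_weight_def by (rule integral_eq_zero_AE)
        with pos show False by simp
      qed
      then have pc: "p * c = a * b"
        using uncorrelated[of s t]
        by (simp add: p_def a_def b_def c_def set_lebesgue_integral_def U_def zero_less_measure_iff)
      have 1: "tail_weight M ?v Y t = p" by (simp add: tail_v p_def U_def)
      have 2: "tail_weight M (w s) Y t = a - s * p"
      proof -
        have "tail_weight M (w s) Y t = (\<integral>\<omega>. indicator U \<omega> * X \<omega> - s * indicator U \<omega> \<partial>M)"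
          unfolding tail_weight_def
          by (intro Bochner_Integration.integral_cong) (auto simp: indicator_def U_def w_def)
        also have "\<dots> = a - s * p"
          using iX i1 by (subst Bochner_Integration.integral_diff) (auto simp: a_def p)
        finally show ?thesis .
      qed
      have 3: "excess_weight M ?v Y t = b - t * p"
      proof -
        have "excess_weight M ?v Y t = (\<integral>\<omega>. indicator U \<omega> * Y \<omega> - t * indicator U \<omega> \<partial>M)"
          unfolding excess_weight_def
          by (intro Bochner_Integration.integral_cong) (auto simp: indicator_def U_def)
        also have "\<dots> = b - t * p"
          using iY i1 by (subst Bochner_Integration.integral_diff) (auto simp: b_def p)
        finally show ?thesis .
      qed
      have 4: "excess_weight M (w s) Y t = c - t * a - s * (b - t * p)"
      proof -
        have "excess_weight M (w s) Y t = (\<integral>\<omega>. (indicator U \<omega> * (X \<omega> * Y \<omega>) - t * (indicator U \<omega> * X \<omega>))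
            - s * (indicator U \<omega> * Y \<omega> - t * indicator U \<omega>) \<partial>M)"
          unfolding excess_weight_def
          by (intro Bochner_Integration.integral_cong)
             (auto simp: indicator_def U_def w_def algebra_simps)
        also have "\<dots> = c - t * a - s * (b - t * p)"
          using iX iY iXY i1 by (simp add: a_def b_def c_def p)
        finally show ?thesis .
      qed
      show "tail_weight M ?v Y t * excess_weight M (w s) Y t
          = tail_weight M (w s) Y t * excess_weight M ?v Y t"
        unfolding 1 2 3 4 using pc by (simp add: algebra_simps)
    qed auto
    then show ?thesis
      by (simp add: tail_v Int_absorb1[OF sets.sets_into_space] Int_commute)
  qed

  \<comment> \<open>Read for fixed \<open>t\<close> and variable \<open>s\<close>, \<open>swap\<close> says that \<open>X\<close> has the same mean excess on
    \<open>B \<inter> {Y \<ge> t}\<close> as on \<open>B\<close>.\<close>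
  let ?u = "indicator {\<omega> \<in> B. t \<le> Y \<omega>} :: 'a \<Rightarrow> real"
  let ?v = "indicator B :: 'a \<Rightarrow> real"
  have tail_u: "tail_weight M ?u X s = measure M {\<omega> \<in> B. s \<le> X \<omega> \<and> t \<le> Y \<omega>}" for s
  proof -
    have "tail_weight M ?u X s = (\<integral>\<omega>. indicator {\<omega> \<in> B. s \<le> X \<omega> \<and> t \<le> Y \<omega>} \<omega> \<partial>M)"
      unfolding tail_weight_def
      by (intro Bochner_Integration.integral_cong) (auto simp: indicator_def)
    then show ?thesis by (simp add: Int_absorb1[OF sets.sets_into_space] Int_commute)
  qed
  have tail_v: "tail_weight M ?v X s = measure M {\<omega> \<in> B. s \<le> X \<omega>}" for s
  proof -
    have "tail_weight M ?v X s = (\<integral>\<omega>. indicator {\<omega> \<in> B. s \<le> X \<omega>} \<omega> \<partial>M)"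
      unfolding tail_weight_def
      by (intro Bochner_Integration.integral_cong) (auto simp: indicator_def)
    then show ?thesis by (simp add: Int_absorb1[OF sets.sets_into_space] Int_commute)
  qed
  have excess_u: "excess_weight M ?u X s = tail_weight M (w s) Y t" for s
    unfolding tail_weight_def excess_weight_def
    by (intro Bochner_Integration.integral_cong) (auto simp: indicator_def w_def)
  have excess_v: "excess_weight M ?v X s = (\<integral>\<omega>. w s \<omega> \<partial>M)" for s
    by (simp add: excess_weight_def w_def)
  have "tail_weight M ?v X s * (\<integral>\<omega>. ?u \<omega> \<partial>M) = tail_weight M ?u X s * (\<integral>\<omega>. ?v \<omega> \<partial>M)"
    by (rule tail_weights_proportional[OF weight_ind_X weight_ind_X])
       (use swap in \<open>auto simp: tail_u tail_v excess_u excess_v mult_ac\<close>)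
  then show ?thesis
    by (simp add: tail_u tail_v Int_absorb1[OF sets.sets_into_space] Int_commute)
qed

section \<open>Vanishing conditional correlations\<close>

lemma cond_cov_eq_0_iff:
  assumes "measure M U > 0"
  shows "cond_cov M U Y Z = 0 \<longleftrightarrow>
    measure M U * (LINT \<omega>:U|M. Y \<omega> * Z \<omega>) = (LINT \<omega>:U|M. Y \<omega>) * (LINT \<omega>:U|M. Z \<omega>)"
  using assms by (simp add: cond_cov_def cond_mean_def field_simps)

lemma set_integrable_product:
  fixes Y Z :: "'a \<Rightarrow> real"
  assumes [measurable]: "Y \<in> borel_measurable M" "Z \<in> borel_measurable M" "U \<in> sets M"
    and "set_integrable M U (\<lambda>\<omega>. (Y \<omega>)\<^sup>2)" "set_integrable M U (\<lambda>\<omega>. (Z \<omega>)\<^sup>2)"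
  shows "set_integrable M U (\<lambda>\<omega>. Y \<omega> * Z \<omega>)"
proof (rule set_integrable_bound)
  show "set_integrable M U (\<lambda>\<omega>. (Y \<omega>)\<^sup>2 + (Z \<omega>)\<^sup>2)"
    using assms by (intro set_integral_add)
  have "\<bar>y * z\<bar> \<le> y\<^sup>2 + z\<^sup>2" for y z :: real
    using sum_squares_bound[of "\<bar>y\<bar>" "\<bar>z\<bar>"] by (simp add: abs_mult)
       (use mult_nonneg_nonneg[of "\<bar>y\<bar>" "\<bar>z\<bar>"] in linarith)
  then show "AE \<omega> in M. \<omega> \<in> U \<longrightarrow> norm (Y \<omega> * Z \<omega>) \<le> norm ((Y \<omega>)\<^sup>2 + (Z \<omega>)\<^sup>2)"
    by simp
qed (simp add: set_borel_measurable_def)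

lemma set_integrable_const:
  assumes "finite_measure M" and "U \<in> sets M"
  shows "set_integrable M U (\<lambda>_. c :: real)"
proof -
  interpret finite_measure M by fact
  show ?thesis using assms by (simp add: set_integrable_def emeasure_eq_measure)
qed

lemma set_integrable_if_square:
  fixes Y :: "'a \<Rightarrow> real"
  assumes "finite_measure M" "U \<in> sets M" "Y \<in> borel_measurable M"
    and "set_integrable M U (\<lambda>\<omega>. (Y \<omega>)\<^sup>2)"
  shows "set_integrable M U Y"
  using set_integrable_product[of Y M "\<lambda>_. 1" U] set_integrable_const[of M U 1] assms by simp

text \<open>
  The square root in \<^const>\<open>cond_sd\<close> is also defined for negative arguments, so that the
  conditional variance has to be shown nonnegative before the diagonal of the correlation matrix is
  known to be \<open>1\<close>. In the degenerate case \<open>Y\<close> is almost surely constant on \<open>U\<close>, which makes its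
  covariances \<open>0\<close>; the conventional value of the correlation off the diagonal thus agrees with the
  vanishing of the covariance.
\<close>

context
  fixes M :: "'a measure" and U :: "'a set" and Y :: "'a \<Rightarrow> real"
  assumes fin: "finite_measure M" and U [measurable]: "U \<in> sets M" and pos: "measure M U > 0"
    and Y [measurable]: "Y \<in> borel_measurable M"
    and sq: "set_integrable M U (\<lambda>\<omega>. (Y \<omega>)\<^sup>2)"
begin

lemma set_integrable_centred_square: "set_integrable M U (\<lambda>\<omega>. (Y \<omega> - c)\<^sup>2)"
  unfolding power2_diff mult.assoc
  by (intro set_integral_add set_integral_diff set_integrable_mult_right sq set_integrable_const fin U)
     (auto intro: set_integrable_if_square[OF fin U Y sq] simp: mult.commute)

lemma cond_mean_centred_square:
  "cond_mean M U (\<lambda>\<omega>. (Y \<omega> - cond_mean M U Y)\<^sup>2)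
     = cond_mean M U (\<lambda>\<omega>. (Y \<omega>)\<^sup>2) - (cond_mean M U Y)\<^sup>2"
proof -
  interpret finite_measure M by fact
  define c where "c = cond_mean M U Y"
  define d where "d = -2 * c"
  have "(LINT \<omega>:U|M. (Y \<omega> - c)\<^sup>2) = (LINT \<omega>:U|M. (Y \<omega>)\<^sup>2 + d * Y \<omega> + c\<^sup>2)"
    by (simp add: power2_diff d_def algebra_simps)
  also have "\<dots> = (LINT \<omega>:U|M. (Y \<omega>)\<^sup>2) + d * (LINT \<omega>:U|M. Y \<omega>) + (LINT \<omega>:U|M. c\<^sup>2)"
    using sq set_integrable_if_square[OF fin U Y sq] set_integrable_const[OF fin U] by (simp add: set_integral_add)
  also have "(LINT \<omega>:U|M. c\<^sup>2) = c\<^sup>2 * measure M U"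
    by (simp add: set_lebesgue_integral_def Int_absorb1[OF sets.sets_into_space] Int_commute)
  also have "(LINT \<omega>:U|M. Y \<omega>) = c * measure M U"
    using pos by (simp add: c_def cond_mean_def)
  finally show ?thesis
    using pos by (simp add: cond_mean_def d_def flip: c_def)
       (simp add: c_def cond_mean_def field_simps power2_eq_square)
qed

lemma cond_sd_eq: "cond_sd M U Y = sqrt (cond_mean M U (\<lambda>\<omega>. (Y \<omega> - cond_mean M U Y)\<^sup>2))"
  by (simp add: cond_sd_def cond_mean_centred_square)

lemma cond_var_nonneg: "cond_mean M U (\<lambda>\<omega>. (Y \<omega> - cond_mean M U Y)\<^sup>2) \<ge> 0"
  by (auto simp: cond_mean_def set_lebesgue_integral_def intro!: divide_nonneg_nonneg integral_nonneg)

lemma cond_sd_square: "cond_sd M U Y * cond_sd M U Y = cond_cov M U Y Y"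
proof -
  have "cond_sd M U Y * cond_sd M U Y = cond_mean M U (\<lambda>\<omega>. (Y \<omega> - cond_mean M U Y)\<^sup>2)"
    using cond_var_nonneg by (simp add: cond_sd_eq)
  then show ?thesis
    unfolding cond_mean_centred_square by (simp add: cond_cov_def power2_eq_square)
qed

lemma cond_cov_eq_0_if_cond_sd_eq_0:
  assumes "cond_sd M U Y = 0" and [measurable]: "Z \<in> borel_measurable M"
  shows "cond_cov M U Y Z = 0"
proof -
  define c where "c = cond_mean M U Y"
  have "(\<integral>\<omega>. indicator U \<omega> * (Y \<omega> - c)\<^sup>2 \<partial>M) = 0"
    using assms pos by (simp add: cond_sd_eq c_def[symmetric])
       (simp add: cond_mean_def set_lebesgue_integral_def)
  then have "AE \<omega> in M. indicator U \<omega> * (Y \<omega> - c)\<^sup>2 = 0"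
    using set_integrable_centred_square[of c]
    by (subst (asm) integral_nonneg_eq_0_iff_AE) (auto simp: set_integrable_def)
  then have "AE \<omega> in M. indicator U \<omega> *\<^sub>R (Y \<omega> * Z \<omega>) = c * (indicator U \<omega> *\<^sub>R Z \<omega>)"
    by eventually_elim (auto simp: indicator_def)
  then have "(LINT \<omega>:U|M. Y \<omega> * Z \<omega>) = (\<integral>\<omega>. c * (indicator U \<omega> *\<^sub>R Z \<omega>) \<partial>M)"
    unfolding set_lebesgue_integral_def by (intro integral_cong_AE) auto
  then have "(LINT \<omega>:U|M. Y \<omega> * Z \<omega>) = c * (LINT \<omega>:U|M. Z \<omega>)"
    by (simp add: set_lebesgue_integral_def)
  then show ?thesis
    by (simp add: cond_cov_def cond_mean_def c_def)
qed

end

lemma cond_cov_commute: "cond_cov M U Y Z = cond_cov M U Z Y"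
  by (simp add: cond_cov_def mult.commute)

lemma cond_cor_matrix_eq_mat_1_iff:
  fixes X :: "'n::finite \<Rightarrow> 'a \<Rightarrow> real"
  assumes "finite_measure M" "U \<in> sets M" "measure M U > 0"
    and "\<And>i. X i \<in> borel_measurable M"
    and "\<And>i. set_integrable M U (\<lambda>\<omega>. (X i \<omega>)\<^sup>2)"
  shows "cond_cor_matrix M U X = mat 1 \<longleftrightarrow>
    (\<forall>i j. i \<noteq> j \<longrightarrow> measure M U * (LINT \<omega>:U|M. X i \<omega> * X j \<omega>)
                       = (LINT \<omega>:U|M. X i \<omega>) * (LINT \<omega>:U|M. X j \<omega>))"
proof -
  have "cond_cor M U X i i = 1" for i
    using cond_sd_square[OF assms(1-3) assms(4,5)[of i]]
    by (auto simp: cond_cor_def)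
  moreover have "cond_cor M U X i j = 0 \<longleftrightarrow> cond_cov M U (X i) (X j) = 0" if "i \<noteq> j" for i j
    using that cond_cov_eq_0_if_cond_sd_eq_0[OF assms(1-3) assms(4,5)[of i], of "X j"]
      cond_cov_eq_0_if_cond_sd_eq_0[OF assms(1-3) assms(4,5)[of j], of "X i"] assms(4)
    by (auto simp: cond_cor_def cond_cov_commute[of M U "X i"])
  ultimately show ?thesis
    using cond_cov_eq_0_iff[OF assms(3)] by (auto simp: cond_cor_matrix_def mat_def vec_eq_iff)
qed

section \<open>Mutual independence from tails\<close>

lemma box_event_in_sets:
  fixes X :: "'n::finite \<Rightarrow> 'a \<Rightarrow> real"
  assumes [measurable]: "\<And>i. X i \<in> borel_measurable M" "\<And>i. A i \<in> sets borel"
  shows "box_event M X A \<in> sets M"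
  unfolding box_event_def by measurable

lemma sets_borel_eq_half_lines:
  "sets (borel :: real measure) = sigma_sets UNIV (insert UNIV (range atLeast))"
proof -
  have "sets (borel :: real measure) = sigma_sets UNIV (range atLeast)"
    by (subst borel_Ici) simp
  also have "\<dots> = sigma_sets UNIV (insert UNIV (range atLeast))"
    by (rule sigma_sets_eqI) (auto intro: sigma_sets_top)
  finally show ?thesis .
qed

text \<open>
  Closed upper half-lines together with the whole line form an intersection-stable generator. The
  members of \<open>S\<close> are the coordinates that are actually restricted.
\<close>

lemma (in prob_space) indep_vars_if_tails:
  fixes X :: "'n::finite \<Rightarrow> 'a \<Rightarrow> real"
  assumes X [measurable]: "\<And>i. X i \<in> borel_measurable M"
    and tails: "\<And>S t. prob (box_event M X (\<lambda>k. if k \<in> S then {t k..} else UNIV))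
                  = (\<Prod>k\<in>S. prob {\<omega> \<in> space M. t k \<le> X k \<omega>})"
  shows "indep_vars (\<lambda>_. borel) X UNIV"
proof (subst indep_vars_finite[where E = "\<lambda>_. insert UNIV (range atLeast)"])
  show "Int_stable (insert UNIV (range atLeast) :: real set set)"
  proof -
    have "{a..} \<inter> {b..} = {max a b..}" for a b :: real by auto
    then show ?thesis by (auto simp: Int_stable_def)
  qed
  show "\<forall>A\<in>UNIV \<rightarrow> insert UNIV (range atLeast).
      prob (\<Inter>j. X j -` A j \<inter> space M) = (\<Prod>j\<in>UNIV. prob (X j -` A j \<inter> space M))"
  proof
    fix A :: "'n \<Rightarrow> real set" assume A: "A \<in> UNIV \<rightarrow> insert UNIV (range atLeast)"
    define S where "S = {k. A k \<noteq> UNIV}"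
    have "\<exists>t. A k \<noteq> UNIV \<longrightarrow> A k = {t..}" for k using A by (auto simp: Pi_iff)
    then obtain t where t: "\<And>k. A k \<noteq> UNIV \<Longrightarrow> A k = {t k..}" by metis
    have A_eq: "A = (\<lambda>k. if k \<in> S then {t k..} else UNIV)"
      by (rule ext) (use t in \<open>auto simp: S_def\<close>)
    have "(\<Inter>j. X j -` A j \<inter> space M) = box_event M X A"
      by (auto simp: box_event_def)
    then have "prob (\<Inter>j. X j -` A j \<inter> space M) = (\<Prod>k\<in>S. prob {\<omega> \<in> space M. t k \<le> X k \<omega>})"
      using tails[of S t] by (simp flip: A_eq)
    also have "\<dots> = (\<Prod>k\<in>S. prob (X k -` A k \<inter> space M))"
      by (intro prod.cong refl arg_cong[where f = prob]) (auto simp: A_eq)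
    also have "\<dots> = (\<Prod>k\<in>UNIV. prob (X k -` A k \<inter> space M))"
      by (rule prod.mono_neutral_left) (auto simp: S_def prob_space)
    finally show "prob (\<Inter>j. X j -` A j \<inter> space M) = (\<Prod>j\<in>UNIV. prob (X j -` A j \<inter> space M))" .
  qed
qed (auto simp: sets_borel_eq_half_lines)

text \<open>
  Exchange is conditional pairwise independence given the restrictions in \<open>R\<close>. It suffices for mutual
  independence because \<open>R\<close> is arbitrary: removing two indices expresses \<open>q S\<close> through three smaller
  sets, unless \<open>q R = 0\<close>, and then \<open>q S\<close> is \<open>0\<close> by monotonicity.
\<close>

lemma prod_if_two_point_exchange:
  fixes q :: "'n set \<Rightarrow> real" and p :: "'n \<Rightarrow> real"
  assumes "finite S" and "q {} = 1" and single: "\<And>i. q {i} = p i"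
    and exchange: "\<And>i j R. i \<noteq> j \<Longrightarrow> i \<notin> R \<Longrightarrow> j \<notin> R \<Longrightarrow> finite R \<Longrightarrow>
          q (insert i (insert j R)) * q R = q (insert i R) * q (insert j R)"
    and antimono: "\<And>R S. R \<subseteq> S \<Longrightarrow> finite S \<Longrightarrow> q S \<le> q R" and nonneg: "\<And>S. 0 \<le> q S"
  shows "q S = (\<Prod>k\<in>S. p k)"
  using \<open>finite S\<close>
proof (induction S rule: finite_psubset_induct)
  case (psubset S)
  consider "S = {}" | i where "S = {i}" | i j R where "S = insert i (insert j R)" "i \<noteq> j" "i \<notin> R" "j \<notin> R"
    by (metis insert_iff mk_disjoint_insert ex_in_conv)
  then show ?case
  proof cases
    case 3
    have fin: "finite R" using 3 psubset.hyps by simp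
    have IH: "q R = prod p R" "q (insert i R) = p i * prod p R" "q (insert j R) = p j * prod p R"
      using 3 fin by (subst psubset.IH; force)+
    show ?thesis
    proof (cases "q R = 0")
      case True
      then have "q S = 0"
        using antimono[of R S] nonneg[of S] 3 psubset.hyps by force
      then show ?thesis using True IH 3 fin by simp
    next
      case False
      have "q S * q R = p i * p j * prod p R * q R"
        using exchange[OF 3(2-4) fin] by (simp add: 3(1) IH mult_ac)
      then show ?thesis using False 3 fin by simp
    qed
  qed (use assms in auto)
qed

section \<open>Classes of conditioning sets\<close>

text \<open>
  The properties shared by bounded intervals and upper half-lines that the equivalence rests on. Cutting
  a set of the class from below stays within the class, unless the cut leaves at most the right
  end point; the condition \<open>A \<inter> {s<..} \<noteq> {}\<close> excludes this. Such cuts produce the tail events, and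
  the sets \<open>E m\<close> remove the conditioning in the limit. Squares are integrable on the sets of the class
  because a bounded interval bounds them, or, for half-lines, because second moments are finite.
\<close>

locale conditioning_class = prob_space M for M :: "'a measure" +
  fixes X :: "'n::finite \<Rightarrow> 'a \<Rightarrow> real" and K :: "real set set" and E :: "nat \<Rightarrow> real set"
  assumes X_meas [measurable]: "\<And>i. X i \<in> borel_measurable M"
    and class_borel: "\<And>A. A \<in> K \<Longrightarrow> A \<in> sets borel"
    and truncate: "\<And>A s. A \<in> K \<Longrightarrow> A \<inter> {s<..} \<noteq> {} \<Longrightarrow> A \<inter> {s..} \<in> K"
    and exhaust: "\<And>m. E m \<in> K" "incseq E" "(\<Union>m. E m) = UNIV"
    and square_integrable: "\<And>A i. A \<in> K \<Longrightarrow>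
          set_integrable M {\<omega> \<in> space M. X i \<omega> \<in> A} (\<lambda>\<omega>. (X i \<omega>)\<^sup>2)"
begin

lemma box_sets: "(\<And>i. A i \<in> K) \<Longrightarrow> box_event M X A \<in> sets M"
  by (intro box_event_in_sets) (auto intro: class_borel)

lemma box_square_integrable:
  assumes "\<And>i. A i \<in> K"
  shows "set_integrable M (box_event M X A) (\<lambda>\<omega>. (X i \<omega>)\<^sup>2)"
  by (rule set_integrable_subset[OF square_integrable[OF assms[of i], of i] box_sets[OF assms]])
     (auto simp: box_event_def)

lemma cond_uncorrelated_iff:
  "cond_uncorrelated M X K \<longleftrightarrow> (\<forall>A i j. (\<forall>k. A k \<in> K) \<longrightarrow> measure M (box_event M X A) > 0 \<longrightarrow> i \<noteq> j \<longrightarrow>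
     prob (box_event M X A) * (LINT \<omega>:box_event M X A|M. X i \<omega> * X j \<omega>)
       = (LINT \<omega>:box_event M X A|M. X i \<omega>) * (LINT \<omega>:box_event M X A|M. X j \<omega>))"
proof -
  have "cond_cor_matrix M (box_event M X A) X = mat 1 \<longleftrightarrow>
    (\<forall>i j. i \<noteq> j \<longrightarrow> prob (box_event M X A) * (LINT \<omega>:box_event M X A|M. X i \<omega> * X j \<omega>)
       = (LINT \<omega>:box_event M X A|M. X i \<omega>) * (LINT \<omega>:box_event M X A|M. X j \<omega>))"
    if "\<forall>k. A k \<in> K" "measure M (box_event M X A) > 0" for A
    using that by (intro cond_cor_matrix_eq_mat_1_iff box_sets box_square_integrable)
      (auto intro: finite_measure_axioms)
  then show ?thesis unfolding cond_uncorrelated_def by blast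
qed

text \<open>
  The indicator of a box is a product of functions of single coordinates, so independence turns each
  of the four integrals over the box into a product over the coordinates.
\<close>

lemma cond_uncorrelated_if_indep:
  assumes indep: "indep_vars (\<lambda>_. borel) X UNIV"
  shows "cond_uncorrelated M X K"
  unfolding cond_uncorrelated_iff
proof (intro allI impI)
  fix A :: "'n \<Rightarrow> real set" and i j :: 'n
  assume A: "\<forall>k. A k \<in> K" and "i \<noteq> j"
  have [measurable]: "A k \<in> sets borel" for k using A class_borel by blast
  have sq: "set_integrable M {\<omega> \<in> space M. X k \<omega> \<in> A k} (\<lambda>\<omega>. (X k \<omega>)\<^sup>2)" for k
    using A square_integrable by blast
  have "set_integrable M {\<omega> \<in> space M. X k \<omega> \<in> A k} (X k)" for k
    by (rule set_integrable_if_square[OF finite_measure_axioms _ _ sq]) measurable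
  then have int: "integrable M (\<lambda>\<omega>. indicator (A k) (X k \<omega>) * X k \<omega>)" for k
    unfolding set_integrable_def
    by (rule Bochner_Integration.integrable_cong[THEN iffD1, rotated 2]) (auto simp: indicator_def)
  \<comment> \<open>Taking \<open>{}\<close>, \<open>{i}\<close>, \<open>{j}\<close> and \<open>{i, j}\<close> for \<open>S\<close> gives the four integrals in question.\<close>
  have factor: "(LINT \<omega>:box_event M X A|M. (\<Prod>k\<in>S. X k \<omega>)) =
     (\<Prod>k\<in>UNIV. \<integral>\<omega>. indicator (A k) (X k \<omega>) * (if k \<in> S then X k \<omega> else 1) \<partial>M)" for S
  proof -
    define Y where "Y k x = indicator (A k) x * (if k \<in> S then x else 1)" for k :: 'n and x :: real
    have [measurable]: "Y k \<in> borel_measurable borel" for k unfolding Y_def by measurable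
    have "(LINT \<omega>:box_event M X A|M. (\<Prod>k\<in>S. X k \<omega>)) = (\<integral>\<omega>. (\<Prod>k\<in>UNIV. Y k (X k \<omega>)) \<partial>M)"
      unfolding set_lebesgue_integral_def
    proof (intro Bochner_Integration.integral_cong refl)
      fix \<omega> assume "\<omega> \<in> space M"
      then have "indicator (box_event M X A) \<omega> = (\<Prod>k\<in>UNIV. indicator (A k) (X k \<omega>) :: real)"
        by (auto simp: box_event_def indicator_def prod_zero_iff)
      moreover have "(\<Prod>k\<in>S. X k \<omega>) = (\<Prod>k\<in>UNIV. if k \<in> S then X k \<omega> else 1)"
        by (simp add: prod.If_cases)
      ultimately show "indicator (box_event M X A) \<omega> *\<^sub>R (\<Prod>k\<in>S. X k \<omega>) = (\<Prod>k\<in>UNIV. Y k (X k \<omega>))"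
        by (simp add: Y_def prod.distrib)
    qed
    also have "\<dots> = (\<Prod>k\<in>UNIV. \<integral>\<omega>. Y k (X k \<omega>) \<partial>M)"
    proof (rule indep_vars_lebesgue_integral)
      show "indep_vars (\<lambda>_. borel) (\<lambda>k \<omega>. Y k (X k \<omega>)) UNIV"
        by (rule indep_vars_compose2[OF indep]) simp
      show "integrable M (\<lambda>\<omega>. Y k (X k \<omega>))" for k
      proof (cases "k \<in> S")
        case False
        have "integrable M (\<lambda>\<omega>. indicator (A k) (X k \<omega>) :: real)"
          by (rule integrable_const_bound[where B = 1]) (auto simp: indicator_def)
        then show ?thesis using False by (simp add: Y_def)
      qed (use int in \<open>simp add: Y_def\<close>)
    qed simp
    finally show ?thesis by (simp add: Y_def)
  qed
  define a where "a k = (\<integral>\<omega>. indicator (A k) (X k \<omega>) * X k \<omega> \<partial>M)" for k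
  define p :: "'n \<Rightarrow> real" where "p k = (\<integral>\<omega>. indicator (A k) (X k \<omega>) \<partial>M)" for k
  have factor': "(LINT \<omega>:box_event M X A|M. (\<Prod>k\<in>S. X k \<omega>)) = (\<Prod>k\<in>S. a k) * (\<Prod>k\<in>-S. p k)" for S
  proof -
    have "(LINT \<omega>:box_event M X A|M. (\<Prod>k\<in>S. X k \<omega>)) = (\<Prod>k\<in>UNIV. if k \<in> S then a k else p k)"
      unfolding factor by (rule prod.cong) (auto simp: a_def p_def)
    then show ?thesis by (simp add: prod.If_cases)
  qed
  have "prob (box_event M X A) = (LINT \<omega>:box_event M X A|M. 1)"
    using box_sets[of A] A
    by (simp add: set_lebesgue_integral_def Int_absorb2[OF sets.sets_into_space])
  also have "\<dots> = (\<Prod>k\<in>UNIV. p k)" using factor'[of "{}"] by simp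
  finally have 0: "prob (box_event M X A) = (\<Prod>k\<in>UNIV. p k)" .
  show "prob (box_event M X A) * (LINT \<omega>:box_event M X A|M. X i \<omega> * X j \<omega>)
       = (LINT \<omega>:box_event M X A|M. X i \<omega>) * (LINT \<omega>:box_event M X A|M. X j \<omega>)"
  proof -
    define r where "r = (\<Prod>k\<in>-{i, j}. p k)"
    have sets: "- {i} = insert j (- {i, j})" "- {j} = insert i (- {i, j})"
      "UNIV = insert i (insert j (- {i, j}))" using \<open>i \<noteq> j\<close> by auto
    have "prob (box_event M X A) = p i * (p j * r)"
      unfolding 0 using \<open>i \<noteq> j\<close> by (subst sets(3)) (simp add: r_def)
    moreover have "(LINT \<omega>:box_event M X A|M. X i \<omega> * X j \<omega>) = a i * a j * r"
      using factor'[of "{i, j}"] \<open>i \<noteq> j\<close> by (simp add: r_def)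
    moreover have "(LINT \<omega>:box_event M X A|M. X i \<omega>) = a i * (p j * r)"
      using factor'[of "{i}"] by (simp add: r_def sets(1))
    moreover have "(LINT \<omega>:box_event M X A|M. X j \<omega>) = a j * (p i * r)"
      using factor'[of "{j}"] \<open>i \<noteq> j\<close> by (simp add: r_def sets(2))
    ultimately show ?thesis by simp
  qed
qed

text \<open>
  Cutting the sides \<open>i\<close> and \<open>j\<close> of a box from below gives a box of the class whenever the open tail
  event has positive probability, so \<open>tail_independence_on_event\<close> applies with the box as the event.
\<close>

lemma tail_exchange_on_box:
  assumes unc: "cond_uncorrelated M X K" and A: "\<And>k. A k \<in> K" and "i \<noteq> j"
  shows "prob (box_event M X (A(i := A i \<inter> {s..}, j := A j \<inter> {t..}))) * prob (box_event M X A)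
     = prob (box_event M X (A(i := A i \<inter> {s..}))) * prob (box_event M X (A(j := A j \<inter> {t..})))"
proof -
  define B where "B = box_event M X A"
  have B: "B \<in> sets M" unfolding B_def by (rule box_sets[OF A])
  have sq: "set_integrable M B (\<lambda>\<omega>. (X k \<omega>)\<^sup>2)" for k
    unfolding B_def by (rule box_square_integrable[OF A])
  have box2: "box_event M X (A(i := A i \<inter> {s..}, j := A j \<inter> {t..})) = {\<omega> \<in> B. s \<le> X i \<omega> \<and> t \<le> X j \<omega>}" for s t
    using \<open>i \<noteq> j\<close> by (auto simp: B_def box_event_def)
  have box1: "box_event M X (A(k := A k \<inter> {s..})) = {\<omega> \<in> B. s \<le> X k \<omega>}" for k s
    by (auto simp: B_def box_event_def)
  show ?thesis
    unfolding box1 box2 B_def[symmetric]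
  proof (rule tail_independence_on_event[OF finite_measure_axioms B])
    show "set_integrable M B (X i)" "set_integrable M B (X j)"
      by (rule set_integrable_if_square[OF finite_measure_axioms B X_meas sq])+
    show "set_integrable M B (\<lambda>\<omega>. X i \<omega> * X j \<omega>)"
      by (intro set_integrable_product sq B X_meas)
    fix s t
    assume pos: "0 < measure M {\<omega> \<in> B. s < X i \<omega> \<and> t < X j \<omega>}"
    then have "{\<omega> \<in> B. s < X i \<omega> \<and> t < X j \<omega>} \<noteq> {}" by (metis measure_empty less_irrefl)
    then have "A i \<inter> {s<..} \<noteq> {}" "A j \<inter> {t<..} \<noteq> {}"
      by (auto simp: B_def box_event_def)
    then have K: "\<forall>k. (A(i := A i \<inter> {s..}, j := A j \<inter> {t..})) k \<in> K"
      using A truncate by simp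
    have "0 < prob {\<omega> \<in> B. s \<le> X i \<omega> \<and> t \<le> X j \<omega>}"
      using pos box_sets[of "A(i := A i \<inter> {s..}, j := A j \<inter> {t..})"] K
      by (elim less_le_trans) (intro finite_measure_mono; auto simp: box2)
    then show "prob {\<omega> \<in> B. s \<le> X i \<omega> \<and> t \<le> X j \<omega>} * (LINT \<omega>:{\<omega> \<in> B. s \<le> X i \<omega> \<and> t \<le> X j \<omega>}|M. X i \<omega> * X j \<omega>)
        = (LINT \<omega>:{\<omega> \<in> B. s \<le> X i \<omega> \<and> t \<le> X j \<omega>}|M. X i \<omega>) * (LINT \<omega>:{\<omega> \<in> B. s \<le> X i \<omega> \<and> t \<le> X j \<omega>}|M. X j \<omega>)"
      using unc K \<open>i \<noteq> j\<close> unfolding cond_uncorrelated_iff box2[symmetric] by blast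
  qed (use X_meas in auto)
qed

lemma eventually_truncated_exhaustion_in_class:
  "eventually (\<lambda>m. E m \<inter> {s..} \<in> K) sequentially"
proof -
  obtain m0 where "s + 1 \<in> E m0" using exhaust(3) by blast
  then have "s + 1 \<in> E m" if "m \<ge> m0" for m using exhaust(2) that by (auto simp: incseq_def)
  then have "E m \<inter> {s..} \<in> K" if "m \<ge> m0" for m
  proof -
    have "s + 1 \<in> E m \<inter> {s<..}"
      using that \<open>\<And>m. m0 \<le> m \<Longrightarrow> s + 1 \<in> E m\<close> by simp
    then show ?thesis using exhaust(1) truncate by blast
  qed
  then show ?thesis by (auto simp: eventually_sequentially)
qed

text \<open>
  The limit of \<open>tail_exchange_on_box\<close> for boxes whose sides are \<open>E m \<inter> {t k..}\<close> for \<open>k \<in> R\<close>, which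
  belong to the class once \<open>m\<close> is large, and \<open>E m\<close> otherwise.
\<close>

lemma tail_exchange:
  fixes t :: "'n \<Rightarrow> real"
  assumes unc: "cond_uncorrelated M X K" and "i \<noteq> j" "i \<notin> R" "j \<notin> R"
    and q_def: "q = (\<lambda>S. prob (box_event M X (\<lambda>k. if k \<in> S then {t k..} else UNIV)))"
  shows "q (insert i (insert j R)) * q R = q (insert i R) * q (insert j R)"
proof -
  define C where "C S k = (if k \<in> S then {t k..} else UNIV)" for S and k :: 'n
  define Q where "Q m S = prob (box_event M X (\<lambda>k. E m \<inter> C S k))" for m S
  have lim: "(\<lambda>m. Q m S) \<longlonglongrightarrow> q S" for S
  proof -
    have "(\<Union>m. box_event M X (\<lambda>k. E m \<inter> C S k)) = box_event M X (C S)"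
    proof (intro subset_antisym subsetI)
      fix \<omega> assume \<omega>: "\<omega> \<in> box_event M X (C S)"
      have "\<exists>m. X k \<omega> \<in> E m" for k using exhaust(3) by blast
      then obtain m where m: "\<And>k. X k \<omega> \<in> E (m k)" by metis
      have sub: "E (m k) \<subseteq> E (Max (range m))" for k
        by (rule incseqD[OF exhaust(2)]) simp
      have "X k \<omega> \<in> E (Max (range m))" for k
        using m[of k] sub[of k] by blast
      then show "\<omega> \<in> (\<Union>m. box_event M X (\<lambda>k. E m \<inter> C S k))"
        using \<omega> by (intro UN_I[of "Max (range m)"]) (auto simp: box_event_def)
    qed (auto simp: box_event_def)
    moreover have "incseq (\<lambda>m. box_event M X (\<lambda>k. E m \<inter> C S k))"
      using exhaust(2) by (auto simp: incseq_def box_event_def)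
    moreover have "range (\<lambda>m. box_event M X (\<lambda>k. E m \<inter> C S k)) \<subseteq> sets M"
      using exhaust(1)[THEN class_borel] by (auto intro!: box_event_in_sets simp: C_def)
    ultimately show ?thesis
      using finite_Lim_measure_incseq[of "\<lambda>m. box_event M X (\<lambda>k. E m \<inter> C S k)"]
      by (simp add: Q_def q_def C_def[abs_def])
  qed
  have "eventually (\<lambda>m. \<forall>k. E m \<inter> {t k..} \<in> K) sequentially"
    by (intro eventually_all_finite eventually_truncated_exhaustion_in_class)
  then have "eventually (\<lambda>m. Q m (insert i (insert j R)) * Q m R = Q m (insert i R) * Q m (insert j R)) sequentially"
  proof eventually_elim
    case (elim m)
    define A where "A k = E m \<inter> C R k" for k
    have "A k \<in> K" for k using elim exhaust(1) by (simp add: A_def C_def)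
    moreover have "(\<lambda>k. E m \<inter> C (insert i R) k) = A(i := A i \<inter> {t i..})"
      "(\<lambda>k. E m \<inter> C (insert j R) k) = A(j := A j \<inter> {t j..})"
      "(\<lambda>k. E m \<inter> C (insert i (insert j R)) k) = A(i := A i \<inter> {t i..}, j := A j \<inter> {t j..})"
      "(\<lambda>k. E m \<inter> C R k) = A"
      using assms(2-4) by (auto simp: A_def C_def fun_eq_iff)
    ultimately show ?case
      using tail_exchange_on_box[OF unc, of A i j] \<open>i \<noteq> j\<close> by (simp add: Q_def)
  qed
  then have "(\<lambda>m. Q m (insert i (insert j R)) * Q m R) \<longlonglongrightarrow> q (insert i R) * q (insert j R)"
    using tendsto_mult[OF lim lim] by (subst tendsto_cong) auto
  with tendsto_mult[OF lim lim] show ?thesis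
    by (rule LIMSEQ_unique)
qed

theorem indep_iff_cond_uncorrelated:
  "indep_vars (\<lambda>_. borel) X UNIV \<longleftrightarrow> cond_uncorrelated M X K"
proof
  assume unc: "cond_uncorrelated M X K"
  show "indep_vars (\<lambda>_. borel) X UNIV"
  proof (rule indep_vars_if_tails[OF X_meas])
    fix S and t :: "'n \<Rightarrow> real"
    define q where "q = (\<lambda>S. prob (box_event M X (\<lambda>k. if k \<in> S then {t k..} else UNIV)))"
    have "q S = (\<Prod>k\<in>S. prob {\<omega> \<in> space M. t k \<le> X k \<omega>})"
    proof (rule prod_if_two_point_exchange)
      show "q {} = 1" by (simp add: q_def box_event_def prob_space)
      show "q {i} = prob {\<omega> \<in> space M. t i \<le> X i \<omega>}" for i
        unfolding q_def by (rule arg_cong[where f = prob]) (auto simp: box_event_def split: if_splits)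
      show "q S \<le> q R" if "R \<subseteq> S" for R S
        unfolding q_def using that
        by (intro finite_measure_mono box_event_in_sets) (auto simp: box_event_def split: if_splits)
    qed (use tail_exchange[OF unc _ _ _ q_def] in \<open>auto simp: q_def\<close>)
    then show "prob (box_event M X (\<lambda>k. if k \<in> S then {t k..} else UNIV))
        = (\<Prod>k\<in>S. prob {\<omega> \<in> space M. t k \<le> X k \<omega>})"
      by (simp add: q_def)
  qed
qed (rule cond_uncorrelated_if_indep)

end

section \<open>Bounded intervals and half-lines\<close>

lemma (in prob_space) conditioning_class_intervals:
  fixes X :: "'n::finite \<Rightarrow> 'a \<Rightarrow> real"
  assumes X [measurable]: "\<And>i. X i \<in> borel_measurable M"
  shows "conditioning_class M X {{a..b} | a b. a < b} (\<lambda>m. {- real m - 1..real m + 1})"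
proof (unfold_locales, goal_cases)
  case (3 A s)
  then obtain a b where A: "A = {a..b}" "a < b" by auto
  with 3 have "max a s < b" by auto
  moreover have "A \<inter> {s..} = {max a s..b}" using A by auto
  ultimately show ?case by blast
next
  case (4 m)
  have "- real m - 1 < real m + 1" by simp
  then show ?case by blast
next
  case 6
  have "\<exists>m. - real m - 1 \<le> x \<and> x \<le> real m + 1" for x :: real
  proof -
    obtain m where "\<bar>x\<bar> \<le> real m" using real_arch_simple by blast
    then show ?thesis by (intro exI[of _ m]) linarith
  qed
  then show ?case by auto
next
  case (7 A i)
  then obtain a b where A: "A = {a..b}" by auto
  have "\<bar>x\<bar> \<le> \<bar>a\<bar> + \<bar>b\<bar>" if "a \<le> x" "x \<le> b" for x
    using that by linarith
  then have bound: "x\<^sup>2 \<le> (\<bar>a\<bar> + \<bar>b\<bar>)\<^sup>2" if "a \<le> x" "x \<le> b" for x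
    using that by (simp add: abs_le_square_iff[symmetric])
  show ?case
    unfolding set_integrable_def A
    by (rule integrable_const_bound[where B = "(\<bar>a\<bar> + \<bar>b\<bar>)\<^sup>2"])
       (auto simp: indicator_def bound)
qed (auto simp: incseq_def)

lemma (in prob_space) conditioning_class_half_lines:
  fixes X :: "'n::finite \<Rightarrow> 'a \<Rightarrow> real"
  assumes X [measurable]: "\<And>i. X i \<in> borel_measurable M"
    and sq: "\<And>i. integrable M (\<lambda>\<omega>. (X i \<omega>)\<^sup>2)"
  shows "conditioning_class M X {{t..} | t. True} (\<lambda>m. {- real m..})"
proof (unfold_locales, goal_cases)
  case (3 A s)
  then obtain a where "A = {a..}" by auto
  then have "A \<inter> {s..} = {max a s..}" by auto
  then show ?case by blast
next
  case 6
  have "\<exists>m. - real m \<le> x" for x :: real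
    using real_arch_simple[of "- x"] by (auto intro: exI simp: minus_le_iff)
  then show ?case by auto
next
  case (7 A i)
  then have [measurable]: "A \<in> sets borel" by auto
  show ?case
    unfolding set_integrable_def by (rule integrable_mult_indicator[OF _ sq]) measurable
qed (auto simp: incseq_def)

theorem theorem5:
  fixes M :: "'a measure" and X :: "'n::finite \<Rightarrow> 'a \<Rightarrow> real"
  assumes "prob_space M"
    and "CARD('n) \<ge> 2"
    and "\<And>i. X i \<in> borel_measurable M"
  shows "(prob_space.indep_vars M (\<lambda>_. borel) X UNIV
            \<longleftrightarrow> cond_uncorrelated M X {{a..b} | a b. a < b})
       \<and> ((\<forall>i. integrable M (\<lambda>\<omega>. (X i \<omega>)\<^sup>2)) \<longrightarrow>
           (prob_space.indep_vars M (\<lambda>_. borel) X UNIV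
              \<longleftrightarrow> cond_uncorrelated M X {{t..} | t. True}))"
proof -
  interpret prob_space M by fact
  show ?thesis
    using conditioning_class.indep_iff_cond_uncorrelated[OF conditioning_class_intervals]
      conditioning_class.indep_iff_cond_uncorrelated[OF conditioning_class_half_lines] assms(3)
    by blast
qed

end
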